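(* Suppose $f_1,\dots,f_n$ satisfy the strong convexity and smoothness assumption (S) of the context, and consider the stochastic algorithm described in the context with constant step size $\eta>0$, epoch length $m$ and the following end-of-epoch rule (option 2): $\tilde w_k=w_t$ with $t$ chosen uniformly at random from $\{0,\dots,m-1\}$. Suppose the variance condition (V) of the context holds with constant $\alpha>0$. Let $w_*$ be the minimizer of $F$, and suppose $m$ is sufficiently large so that $$\beta=\frac{1}{\mu\eta\,(1-\eta L(2\alpha+1))\,m}+\frac{2L\eta\alpha}{1-\eta L(2\alpha+1)}<1 .$$ Then for every $k\ge 1$ $$\mathbb{E}[F(\tilde w_k)-F(w_* )]\le \beta^k\,\mathbb{E}[F(\tilde w_0)-F(w_* )].$$
   Context: Let $F(w)=\frac1n\sum_{i=1}^n f_i(w)$, $w\in\mathbb{R}^d$, with $f_i:\mathbb{R}^d\to\mathbb{R}$ twice continuously differentiable. $\|\cdot\|$ is the Euclidean norm. Assumption (S): for each $i$ there is $\mu_i>0$ with $f_i(w)\ge f_i(z)+\nabla f_i(z)^T(w-z)+\frac{\mu_i}{2}\|z-w\|^2$ for all $w,z\in\mathbb{R}^d$, and there is $L>0$ with $\|\nabla f_i(w)-\nabla f_i(z)\|\le L\|w-z\|$ for all $i$ and all $w,z$. Put $\mu=\min_i\mu_i$, so $F$ is $\mu$-strongly convex with $L$-Lipschitz gradient. Algorithm: start from $\tilde w_0\in\mathbb{R}^d$. In epoch $k=1,2,\dots$: set $\tilde w=\tilde w_{k-1}$, $\tilde g=\nabla F(\tilde w)$, $w_0=\tilde w$. Real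 $d\times d$ matrices $\tilde A^{k-1}_1,\dots,\tilde A^{k-1}_n$, determined by the history before epoch $k$, are given, with mean $\tilde A^{k-1}=\frac1n\sum_i\tilde A^{k-1}_i$. For $t=1,\dots,m$: pick $i_t\in\{1,\dots,n\}$ uniformly at random, independently of the past, and set $w_t=w_{t-1}-\eta v_t$, where $$v_t=\nabla f_{i_t}(w_{t-1})-\nabla f_{i_t}(\tilde w)+\tilde g+(\tilde A^{k-1}-\tilde A^{k-1}_{i_t})(w_{t-1}-\tilde w).$$ Finally $\tilde w_k$ is chosen by the end-of-epoch rule (any random choice being independent of everything else). Condition (V) with constant $\alpha>0$: for all epochs $k$ and all $t$, $$\mathbb{E}\big[\|\nabla f_{i_t}(w_{t-1})-\nabla f_{i_t}(\tilde w)-\tilde A^{k-1}_{i_t}(w_{t-1}-\tilde w)\|^2\big]\le\alpha\,\mathbb{E}\big[\|\nabla f_{i_t}(w_{t-1})-\nabla f_{i_t}(\tilde w)\|^2\big],$$ where $\mathbb{E}$ is the expectation over $i_t$ conditional on the past (in particular on $w_{t-1}$ and $\tilde w$). In the conclusion, $\mathbb{E}$ is the expectation over all random choices.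
   Formalization: The formal theorem adds the assumption 1 − ηL(2α+1) > 0; if this quantity is negative then β < 0 < 1 automatically and the claim fails at k = 1 unless w̃_0 = w_*, and if it is zero then β is undefined. *)

theory Defs
  imports "HOL-Probability.Probability"
begin

definition grad :: "('a::real_inner \<Rightarrow> real) \<Rightarrow> 'a \<Rightarrow> 'a" where
  "grad g x = (THE D. GDERIV g x :> D)"

(* H is the Hessian matrix of g. *)
definition twice_continuously_differentiable :: "(real^'d \<Rightarrow> real) \<Rightarrow> bool" where
  "twice_continuously_differentiable g \<longleftrightarrow>
     (\<exists>H :: real^'d \<Rightarrow> real^'d^'d.
        (\<forall>x. GDERIV g x :> grad g x) \<and>
        (\<forall>x. (grad g has_derivative (\<lambda>h. H x *v h)) (at x)) \<and>
        continuous_on UNIV H)"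

definition objective :: "nat \<Rightarrow> (nat \<Rightarrow> real^'d \<Rightarrow> real) \<Rightarrow> real^'d \<Rightarrow> real" where
  "objective n f w = (1 / real n) * (\<Sum>i=1..n. f i w)"

definition mean_matrix :: "nat \<Rightarrow> (nat \<Rightarrow> real^'d^'d) \<Rightarrow> real^'d^'d" where
  "mean_matrix n B = (1 / real n) *\<^sub>R (\<Sum>i=1..n. B i)"

(* mu i is the strong convexity constant of f i; L is common to all i. *)
definition strongly_convex_smooth ::
  "nat \<Rightarrow> (nat \<Rightarrow> real^'d \<Rightarrow> real) \<Rightarrow> (nat \<Rightarrow> real) \<Rightarrow> real \<Rightarrow> bool" where
  "strongly_convex_smooth n f mu L \<longleftrightarrow>
     (\<forall>i\<in>{1..n}. mu i > 0 \<and>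
        (\<forall>w z. f i w \<ge> f i z + grad (f i) z \<bullet> (w - z) + mu i / 2 * (norm (z - w))\<^sup>2)) \<and>
     L > 0 \<and>
     (\<forall>i\<in>{1..n}. \<forall>w z. norm (grad (f i) w - grad (f i) z) \<le> L * norm (w - z))"

(* The direction v_t, where the index i was drawn, w is w_{t-1} and ws is the
   snapshot taken at the start of the epoch. *)
definition direction ::
  "nat \<Rightarrow> (nat \<Rightarrow> real^'d \<Rightarrow> real) \<Rightarrow> (nat \<Rightarrow> real^'d^'d) \<Rightarrow> real^'d \<Rightarrow> nat \<Rightarrow> real^'d \<Rightarrow> real^'d" where
  "direction n f B ws i w =
     grad (f i) w - grad (f i) ws + grad (objective n f) ws + (mean_matrix n B - B i) *v (w - ws)"

(* For is = [i_1, ..., i_t] this is w_t, starting from w_0 = ws. *)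
definition inner_iterate ::
  "nat \<Rightarrow> (nat \<Rightarrow> real^'d \<Rightarrow> real) \<Rightarrow> real \<Rightarrow> (nat \<Rightarrow> real^'d^'d) \<Rightarrow> real^'d \<Rightarrow> nat list \<Rightarrow> real^'d" where
  "inner_iterate n f \<eta> B ws is = foldl (\<lambda>w i. w - \<eta> *\<^sub>R direction n f B ws i w) ws is"

(* The random choices of one epoch: the indices [i_1, ..., i_m] and the position
   t in {0..<m} of the inner iterate that becomes the next snapshot. *)
type_synonym epoch = "nat list \<times> nat"

(* The epochs completed so far, the most recent one first. *)
type_synonym history = "epoch list"

(* A h i is the i-th matrix used in the epoch that follows the history h. The starting
   point w0 is not random, so all earlier iterates are functions of h, and an arbitrary
   function A of h covers every choice of matrices determined by the history. *)
primrec snapshot ::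
  "nat \<Rightarrow> (nat \<Rightarrow> real^'d \<Rightarrow> real) \<Rightarrow> real \<Rightarrow> (history \<Rightarrow> nat \<Rightarrow> real^'d^'d) \<Rightarrow> real^'d \<Rightarrow> history \<Rightarrow> real^'d" where
  "snapshot n f \<eta> A w0 [] = w0"
| "snapshot n f \<eta> A w0 (e # h) =
     inner_iterate n f \<eta> (A h) (snapshot n f \<eta> A w0 h) (take (snd e) (fst e))"

definition index_pmf :: "nat \<Rightarrow> nat pmf" where
  "index_pmf n = pmf_of_set {1..n}"

definition epoch_pmf :: "nat \<Rightarrow> nat \<Rightarrow> epoch pmf" where
  "epoch_pmf n m = pair_pmf (replicate_pmf m (index_pmf n)) (pmf_of_set {0..<m})"

(* The law of all random choices made in the first k epochs. *)
definition history_pmf :: "nat \<Rightarrow> nat \<Rightarrow> nat \<Rightarrow> history pmf" where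
  "history_pmf n m k = replicate_pmf k (epoch_pmf n m)"

(* In epoch k, at step t, the past consists of the history h of the preceding epochs and
   the indices is = [i_1, ..., i_{t-1}]. There are finitely many pasts, so conditioning on
   the past means fixing one of positive probability; what remains is the expectation over
   the index i = i_t. *)
definition variance_condition ::
  "nat \<Rightarrow> nat \<Rightarrow> (nat \<Rightarrow> real^'d \<Rightarrow> real) \<Rightarrow> real \<Rightarrow> (history \<Rightarrow> nat \<Rightarrow> real^'d^'d) \<Rightarrow> real^'d \<Rightarrow> real \<Rightarrow> bool" where
  "variance_condition n m f \<eta> A w0 \<alpha> \<longleftrightarrow>
     (\<forall>k\<ge>1. \<forall>h\<in>set_pmf (history_pmf n m (k - 1)).
      \<forall>t\<in>{1..m}. \<forall>is\<in>set_pmf (replicate_pmf (t - 1) (index_pmf n)).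
        let ws = snapshot n f \<eta> A w0 h;
            w = inner_iterate n f \<eta> (A h) ws is
        in measure_pmf.expectation (index_pmf n)
             (\<lambda>i. (norm (grad (f i) w - grad (f i) ws - A h i *v (w - ws)))\<^sup>2)
           \<le> \<alpha> * measure_pmf.expectation (index_pmf n)
               (\<lambda>i. (norm (grad (f i) w - grad (f i) ws))\<^sup>2))"

end

theory Submission
  imports Defs
begin

text \<open>Write \<open>gap w\<close> for the excess of the objective at \<open>w\<close> over its minimum and \<open>ws\<close> for the
  snapshot of the current epoch. The proof controls the squared distance to the minimizer along
  the inner loop.

  Averaged over the index, the direction is the gradient of the objective
  (\<open>avg_direction\<close>), and convexity bounds its inner product with \<open>w - wstar\<close> below by \<open>gap w\<close>.
  The second moment of the direction is at most the squared gradient plus a variance. The variance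
  condition bounds the latter by \<open>\<alpha>\<close> times the mean of \<open>\<parallel>grad (f i) w - grad (f i) ws\<parallel>\<^sup>2\<close>, and this
  is at most twice the sum of the mean squared changes of the component gradients between \<open>w\<close> and
  the minimizer and between \<open>ws\<close> and the minimizer. Smoothness together with convexity
  bounds each of these two by \<open>2 * L\<close> times the gap (\<open>mean_gradient_deviation_le_gap\<close>), so that the
  second moment is at most
  \<open>2 * L * (2 * \<alpha> + 1) * gap w + 4 * L * \<alpha> * gap ws\<close> (\<open>direction_second_moment\<close>).

  One step therefore lowers the expected squared distance by a positive multiple of \<open>gap w\<close>, up to
  an error proportional to \<open>\<eta>\<^sup>2 * gap ws\<close> (\<open>step_distance\<close>). Summing over an epoch bounds the total
  expected gap by the initial squared distance, itself at most \<open>2 / \<mu> * gap ws\<close> by strong convexity,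
  plus \<open>m\<close> times that error. Dividing by \<open>m\<close> gives the expected gap at a uniformly
  chosen iterate, and the two contributions are the two summands of \<open>\<beta>\<close>
  (\<open>epoch_contraction\<close>). This holds for each history of the earlier epochs, so the
  epochs compose to the factor \<open>\<beta> ^ k\<close>.\<close>

section \<open>Smooth convex functions\<close>

lemma gderiv_unique:
  assumes "GDERIV f x :> D" and "GDERIV f x :> E"
  shows "D = E"
proof -
  have "(\<lambda>h. h \<bullet> D) = (\<lambda>h. h \<bullet> E)"
    using assms unfolding gderiv_def by (rule has_derivative_unique)
  then have "(D - E) \<bullet> D = (D - E) \<bullet> E"
    by metis
  then have "(D - E) \<bullet> (D - E) = 0"
    by (simp add: inner_diff_right)
  then show ?thesis by simp
qed

lemma grad_eqI: "GDERIV f x :> D \<Longrightarrow> grad f x = D"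
  unfolding grad_def by (blast intro: gderiv_unique)

lemma gderiv_zero_at_minimum:
  assumes "GDERIV f x :> D" and "\<And>y. f x \<le> f y"
  shows "D = 0"
proof -
  have "(\<lambda>h. h \<bullet> D) = (\<lambda>h. 0)"
    using assms by (intro has_derivative_local_min[of f _ x]) (auto simp: gderiv_def)
  then have "D \<bullet> D = 0" by metis
  then show ?thesis by simp
qed

text \<open>Along the segment from \<open>x\<close> to \<open>y\<close>, subtracting the quadratic upper model from \<open>f\<close>
  leaves a function of the parameter \<open>t\<close> whose derivative is nonpositive by Cauchy-Schwarz and
  the Lipschitz bound.\<close>

lemma lipschitz_gradient_upper_bound:
  assumes deriv: "\<And>x. GDERIV f x :> g x"
    and lip: "\<And>x y. norm (g x - g y) \<le> L * norm (x - y)"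
  shows "f y \<le> f x + g x \<bullet> (y - x) + L / 2 * (norm (y - x))\<^sup>2"
proof -
  define d where "d = y - x"
  define \<phi> where "\<phi> t = f (x + t *\<^sub>R d) - t * (g x \<bullet> d) - L / 2 * t\<^sup>2 * (norm d)\<^sup>2" for t :: real
  have "\<phi> 1 \<le> \<phi> 0"
  proof (rule DERIV_nonpos_imp_nonincreasing[where f = \<phi>])
    fix t :: real
    assume t: "0 \<le> t"
    have line: "((\<lambda>t. x + t *\<^sub>R d) has_derivative (\<lambda>s. s *\<^sub>R d)) (at t)"
      by (auto intro!: derivative_eq_intros)
    have "((\<lambda>t. f (x + t *\<^sub>R d)) has_derivative (\<lambda>s. (s *\<^sub>R d) \<bullet> g (x + t *\<^sub>R d))) (at t)"
      using has_derivative_compose[OF line deriv[unfolded gderiv_def]] .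
    then have comp: "((\<lambda>t. f (x + t *\<^sub>R d)) has_field_derivative (g (x + t *\<^sub>R d) \<bullet> d)) (at t)"
      by (simp add: has_field_derivative_def inner_commute mult_commute_abs)
    have "((\<lambda>t. t * (g x \<bullet> d) + L / 2 * t\<^sup>2 * (norm d)\<^sup>2) has_field_derivative
            (g x \<bullet> d + L * t * (norm d)\<^sup>2)) (at t)"
      by (auto intro!: derivative_eq_intros)
    from DERIV_diff[OF comp this]
    have "(\<phi> has_field_derivative
            (g (x + t *\<^sub>R d) \<bullet> d - g x \<bullet> d - L * t * (norm d)\<^sup>2)) (at t)"
      by (simp add: \<phi>_def[abs_def] algebra_simps)
    moreover have "g (x + t *\<^sub>R d) \<bullet> d - g x \<bullet> d - L * t * (norm d)\<^sup>2 \<le> 0"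
    proof -
      have "g (x + t *\<^sub>R d) \<bullet> d - g x \<bullet> d \<le> norm (g (x + t *\<^sub>R d) - g x) * norm d"
        by (simp add: inner_diff_left[symmetric] norm_cauchy_schwarz)
      also have "\<dots> \<le> L * norm (x + t *\<^sub>R d - x) * norm d"
        by (intro mult_right_mono lip) simp
      also have "\<dots> = L * t * (norm d)\<^sup>2"
        using t by (simp add: power2_eq_square)
      finally show ?thesis by simp
    qed
    ultimately show "\<exists>D. DERIV \<phi> t :> D \<and> D \<le> 0" by blast
  qed simp
  then show ?thesis
    by (simp add: \<phi>_def d_def)
qed

text \<open>Subtracting from \<open>f\<close> its tangent at \<open>z\<close> gives a function that is minimal at \<open>z\<close> and has
  gradient \<open>g w - g z\<close> at \<open>w\<close>. By the quadratic upper bound, a gradient step of length \<open>1 / L\<close>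
  from \<open>w\<close> lowers it by at least \<open>1 / (2 * L)\<close> times the squared norm of that gradient, and the
  value reached is still at least the minimum.\<close>

lemma gradient_difference_bound:
  assumes deriv: "\<And>x. GDERIV f x :> g x"
    and lip: "\<And>x y. norm (g x - g y) \<le> L * norm (x - y)"
    and convex: "\<And>w z. f w \<ge> f z + g z \<bullet> (w - z)"
    and "L > 0"
  shows "(norm (g w - g z))\<^sup>2 \<le> 2 * L * (f w - f z - g z \<bullet> (w - z))"
proof -
  define p where "p = g w - g z"
  define y where "y = w - (1 / L) *\<^sub>R p"
  define a b c where "a = (g w \<bullet> p) / L" and "b = (g z \<bullet> p) / L" and "c = (norm p)\<^sup>2 / L"
  have "f z + g z \<bullet> (y - z) \<le> f w + g w \<bullet> (y - w) + L / 2 * (norm (y - w))\<^sup>2"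
    using convex[where w = y and z = z] lipschitz_gradient_upper_bound[OF deriv lip, of y w] by linarith
  moreover have "g z \<bullet> (y - z) = g z \<bullet> (w - z) - b"
    by (simp add: y_def b_def inner_diff_right)
  moreover have "g w \<bullet> (y - w) = - a"
    by (simp add: y_def a_def)
  moreover have "L / 2 * (norm (y - w))\<^sup>2 = c / 2"
    using \<open>L > 0\<close> by (simp add: y_def c_def power_divide power2_eq_square field_simps)
  moreover have "c = a - b"
    by (simp only: a_def b_def c_def power2_norm_eq_inner diff_divide_distrib[symmetric]
        inner_diff_left[symmetric] p_def)
  ultimately have "c / 2 \<le> f w - f z - g z \<bullet> (w - z)"
    by linarith
  then show ?thesis
    using \<open>L > 0\<close> by (simp add: c_def p_def field_simps)
qed

section \<open>Averages over the indices\<close>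

definition avg :: "nat \<Rightarrow> (nat \<Rightarrow> 'a) \<Rightarrow> 'a::real_vector" where
  "avg n x = (1 / real n) *\<^sub>R (\<Sum>i=1..n. x i)"

lemma avg_add: "avg n (\<lambda>i. x i + y i) = avg n x + avg n y"
  by (simp add: avg_def sum.distrib scaleR_add_right)

lemma avg_diff: "avg n (\<lambda>i. x i - y i) = avg n x - avg n y"
  by (simp add: avg_def sum_subtractf scaleR_diff_right)

lemma avg_const: "n > 0 \<Longrightarrow> avg n (\<lambda>i. c) = c"
  by (simp add: avg_def sum_constant_scaleR)

lemma avg_linear: "linear l \<Longrightarrow> avg n (\<lambda>i. l (x i)) = l (avg n x)"
  by (simp add: avg_def linear_sum linear_scale)

lemma avg_mult_left: "avg n (\<lambda>i. c * x i) = c * avg n x" for c :: real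
  by (simp add: avg_def sum_distrib_left mult_ac)

lemma avg_inner_left: "avg n (\<lambda>i. x i \<bullet> a) = avg n x \<bullet> a"
  by (simp add: avg_def inner_sum_left)

lemma avg_matrix_vector_mult: "avg n (\<lambda>i. B i *v x) = avg n B *v x"
  for B :: "nat \<Rightarrow> real^'c^'r"
proof -
  have "linear (\<lambda>M :: real^'c^'r. M *v x)"
    by (rule linearI) (simp_all add: matrix_vector_mult_add_rdistrib scaleR_matrix_vector_assoc)
  from avg_linear[OF this] show ?thesis .
qed

lemma avg_mono:
  fixes x y :: "nat \<Rightarrow> real"
  assumes "\<And>i. i \<in> {1..n} \<Longrightarrow> x i \<le> y i"
  shows "avg n x \<le> avg n y"
  unfolding avg_def real_scaleR_def using assms by (intro mult_left_mono sum_mono) auto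

text \<open>The mean square of a centred vector that is translated by \<open>G\<close> is its variance plus
  \<open>\<parallel>G\<parallel>\<^sup>2\<close>, and a variance is at most the mean square of the uncentred vector.\<close>

lemma avg_norm_square_centred:
  fixes x :: "nat \<Rightarrow> 'a::real_inner"
  assumes "n > 0"
  shows "avg n (\<lambda>i. (norm (x i - avg n x + G))\<^sup>2) \<le> avg n (\<lambda>i. (norm (x i))\<^sup>2) + (norm G)\<^sup>2"
proof -
  let ?c = "G - avg n x"
  have "avg n (\<lambda>i. (norm (x i - avg n x + G))\<^sup>2)
      = avg n (\<lambda>i. (norm (x i))\<^sup>2 + 2 * (x i \<bullet> ?c) + ?c \<bullet> ?c)"
    by (rule arg_cong[of _ _ "avg n"])
       (simp add: fun_eq_iff power2_norm_eq_inner algebra_simps inner_commute)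
  also have "\<dots> = avg n (\<lambda>i. (norm (x i))\<^sup>2) + 2 * (avg n x \<bullet> ?c) + ?c \<bullet> ?c"
    by (simp only: avg_add avg_mult_left avg_inner_left avg_const[OF assms])
  also have "\<dots> = avg n (\<lambda>i. (norm (x i))\<^sup>2) + (norm G)\<^sup>2 - (norm (avg n x))\<^sup>2"
    by (simp add: power2_norm_eq_inner algebra_simps inner_commute)
  finally show ?thesis by simp
qed

lemma norm_avg_square_le:
  fixes x :: "nat \<Rightarrow> 'a::real_inner"
  assumes "n > 0"
  shows "(norm (avg n x))\<^sup>2 \<le> avg n (\<lambda>i. (norm (x i))\<^sup>2)"
proof -
  have "0 \<le> avg n (\<lambda>i. (norm (x i - avg n x))\<^sup>2)"
    by (simp add: avg_def sum_nonneg)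
  also have "avg n (\<lambda>i. (norm (x i - avg n x))\<^sup>2)
      = avg n (\<lambda>i. (norm (x i))\<^sup>2 + (-2) * (x i \<bullet> avg n x) + avg n x \<bullet> avg n x)"
    by (rule arg_cong[of _ _ "avg n"])
       (simp add: fun_eq_iff power2_norm_eq_inner algebra_simps inner_commute)
  also have "\<dots> = avg n (\<lambda>i. (norm (x i))\<^sup>2) - (norm (avg n x))\<^sup>2"
    by (simp only: avg_add avg_mult_left avg_inner_left avg_const[OF assms])
       (simp add: power2_norm_eq_inner)
  finally show ?thesis by simp
qed

lemma objective_eq_avg: "objective n f w = avg n (\<lambda>i. f i w)"
  by (simp add: objective_def avg_def)

lemma mean_matrix_eq_avg: "mean_matrix n B = avg n B"
  by (simp add: mean_matrix_def avg_def)

lemma expectation_index_eq_avg: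
  fixes x :: "nat \<Rightarrow> real"
  shows "n > 0 \<Longrightarrow> measure_pmf.expectation (index_pmf n) x = avg n x"
  by (simp add: index_pmf_def integral_pmf_of_set avg_def)

lemma gderiv_avg:
  assumes "\<And>i. i \<in> {1..n} \<Longrightarrow> GDERIV (f i) x :> D i"
  shows "GDERIV (\<lambda>x. avg n (\<lambda>i. f i x)) x :> avg n D"
proof -
  have "((\<lambda>x. (1 / real n) *\<^sub>R (\<Sum>i=1..n. f i x)) has_derivative
          (\<lambda>h. (1 / real n) *\<^sub>R (\<Sum>i=1..n. h \<bullet> D i))) (at x)"
    using assms unfolding gderiv_def
    by (intro has_derivative_scaleR_right has_derivative_sum) auto
  then show ?thesis
    unfolding gderiv_def by (simp add: avg_def inner_sum_right)
qed

section \<open>Expectations over finitely supported laws\<close>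

lemma expectation_mono_finite:
  fixes x y :: "'a \<Rightarrow> real"
  assumes "finite (set_pmf p)" and "\<And>a. a \<in> set_pmf p \<Longrightarrow> x a \<le> y a"
  shows "measure_pmf.expectation p x \<le> measure_pmf.expectation p y"
  using assms by (intro integral_mono_AE) (auto simp: integrable_measure_pmf_finite AE_measure_pmf_iff)

lemma expectation_bind_finite:
  fixes h :: "'b \<Rightarrow> real"
  assumes "finite (set_pmf p)" and "\<And>a. a \<in> set_pmf p \<Longrightarrow> finite (set_pmf (q a))"
  shows "measure_pmf.expectation (bind_pmf p q) h
       = measure_pmf.expectation p (\<lambda>a. measure_pmf.expectation (q a) h)"
  using assms
  by (subst pmf_expectation_bind[of "set_pmf p"])
     (auto simp: integral_measure_pmf[of "set_pmf p"])

lemma finite_set_replicate_pmf: "finite (set_pmf p) \<Longrightarrow> finite (set_pmf (replicate_pmf k p))"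
  by (simp add: set_replicate_pmf lists_eq_set finite_lists_length_eq)

lemma expectation_replicate_snoc:
  fixes h :: "'a list \<Rightarrow> real"
  assumes "finite (set_pmf p)"
  shows "measure_pmf.expectation (replicate_pmf (Suc t) p) h
       = measure_pmf.expectation (replicate_pmf t p)
           (\<lambda>xs. measure_pmf.expectation p (\<lambda>x. h (xs @ [x])))"
proof -
  have "replicate_pmf (Suc t) p
      = bind_pmf (replicate_pmf t p) (\<lambda>xs. map_pmf (\<lambda>x. xs @ [x]) p)"
    using replicate_pmf_distrib[of t 1 p]
    by (simp add: map_pmf_def bind_assoc_pmf bind_return_pmf)
  then show ?thesis
    using assms by (simp add: expectation_bind_finite finite_set_replicate_pmf del: replicate_pmf.simps)
qed

text \<open>Drawing the first entry of the list last: the histories of the algorithm grow at the front.\<close>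

lemma expectation_replicate_Cons:
  fixes h :: "'a list \<Rightarrow> real"
  assumes "finite (set_pmf p)"
  shows "measure_pmf.expectation (replicate_pmf (Suc t) p) h
       = measure_pmf.expectation (replicate_pmf t p)
           (\<lambda>xs. measure_pmf.expectation p (\<lambda>x. h (x # xs)))"
proof -
  have "replicate_pmf (Suc t) p
      = bind_pmf (replicate_pmf t p) (\<lambda>xs. map_pmf (\<lambda>x. x # xs) p)"
    by (simp add: map_pmf_def bind_commute_pmf[of p])
  then show ?thesis
    using assms by (simp add: expectation_bind_finite finite_set_replicate_pmf del: replicate_pmf.simps)
qed

lemma map_take_replicate_pmf:
  assumes "t \<le> m"
  shows "map_pmf (take t) (replicate_pmf m p) = replicate_pmf t p"
proof -
  have "replicate_pmf m p = bind_pmf (replicate_pmf t p)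
          (\<lambda>xs. bind_pmf (replicate_pmf (m - t) p) (\<lambda>ys. return_pmf (xs @ ys)))"
    using replicate_pmf_distrib[of t "m - t" p] assms by simp
  then have "map_pmf (take t) (replicate_pmf m p) = bind_pmf (replicate_pmf t p)
          (\<lambda>xs. bind_pmf (replicate_pmf (m - t) p) (\<lambda>ys. return_pmf (take t (xs @ ys))))"
    by (simp add: map_bind_pmf)
  also have "\<dots> = bind_pmf (replicate_pmf t p) (\<lambda>xs. return_pmf xs)"
    by (intro bind_pmf_cong refl) (auto simp: set_replicate_pmf)
  finally show ?thesis by (simp add: bind_return_pmf')
qed

lemma finite_set_index_pmf: "n > 0 \<Longrightarrow> finite (set_pmf (index_pmf n))"
  by (simp add: index_pmf_def)

lemma finite_set_epoch_pmf: "n > 0 \<Longrightarrow> m > 0 \<Longrightarrow> finite (set_pmf (epoch_pmf n m))"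
  by (simp add: epoch_pmf_def finite_set_replicate_pmf finite_set_index_pmf)

text \<open>Since the position \<open>t\<close> is independent of the indices, keeping the first \<open>t\<close> of the \<open>m\<close>
  indices amounts to drawing only \<open>t\<close> of them.\<close>

lemma expectation_epoch:
  fixes h :: "nat list \<Rightarrow> real"
  assumes "n > 0" and "m > 0"
  shows "measure_pmf.expectation (epoch_pmf n m) (\<lambda>e. h (take (snd e) (fst e)))
       = (\<Sum>t<m. measure_pmf.expectation (replicate_pmf t (index_pmf n)) h) / real m"
proof -
  let ?R = "replicate_pmf m (index_pmf n)"
  have fin: "finite (set_pmf ?R)"
    using assms by (simp add: finite_set_replicate_pmf finite_set_index_pmf)
  have "epoch_pmf n m = bind_pmf (pmf_of_set {0..<m}) (\<lambda>t. map_pmf (\<lambda>xs. (xs, t)) ?R)"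
    unfolding epoch_pmf_def pair_pmf_def map_pmf_def by (rule bind_commute_pmf)
  then have "measure_pmf.expectation (epoch_pmf n m) (\<lambda>e. h (take (snd e) (fst e)))
      = measure_pmf.expectation (pmf_of_set {0..<m})
          (\<lambda>t. measure_pmf.expectation ?R (\<lambda>xs. h (take t xs)))"
    using assms fin by (simp add: expectation_bind_finite)
  also have "\<dots> = (\<Sum>t<m. measure_pmf.expectation ?R (\<lambda>xs. h (take t xs))) / real m"
    using assms by (subst integral_pmf_of_set) (auto simp: atLeast0LessThan lessThan_empty_iff)
  also have "(\<Sum>t<m. measure_pmf.expectation ?R (\<lambda>xs. h (take t xs)))
      = (\<Sum>t<m. measure_pmf.expectation (replicate_pmf t (index_pmf n)) h)"
  proof (rule sum.cong)
    fix t assume "t \<in> {..<m}"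
    then have "replicate_pmf t (index_pmf n) = map_pmf (take t) ?R"
      by (simp add: map_take_replicate_pmf)
    then show "measure_pmf.expectation ?R (\<lambda>xs. h (take t xs))
        = measure_pmf.expectation (replicate_pmf t (index_pmf n)) h"
      by simp
  qed simp
  finally show ?thesis .
qed

section \<open>The objective near its minimizer\<close>

locale strongly_convex_average =
  fixes n :: nat and f :: "nat \<Rightarrow> real^'d \<Rightarrow> real" and mus :: "nat \<Rightarrow> real"
    and \<mu> L :: real and wstar :: "real^'d"
  assumes n_pos: "n > 0"
    and gderiv: "\<And>i x. i \<in> {1..n} \<Longrightarrow> GDERIV (f i) x :> grad (f i) x"
    and scs: "strongly_convex_smooth n f mus L"
    and mu_eq: "\<mu> = Min (mus ` {1..n})"
    and minimizer: "\<And>w. objective n f wstar \<le> objective n f w"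
begin

definition gap :: "real^'d \<Rightarrow> real" where
  "gap w = objective n f w - objective n f wstar"

lemma L_pos: "L > 0"
  using scs by (simp add: strongly_convex_smooth_def)

lemma mu_pos: "\<mu> > 0"
  using scs n_pos by (auto simp: mu_eq strongly_convex_smooth_def)

lemma strongly_convex_component:
  assumes "i \<in> {1..n}"
  shows "f i w \<ge> f i z + grad (f i) z \<bullet> (w - z) + \<mu> / 2 * (norm (z - w))\<^sup>2"
proof -
  have "\<mu> \<le> mus i"
    using assms by (simp add: mu_eq)
  then have "\<mu> / 2 * (norm (z - w))\<^sup>2 \<le> mus i / 2 * (norm (z - w))\<^sup>2"
    by (intro mult_right_mono) auto
  moreover have "f i w \<ge> f i z + grad (f i) z \<bullet> (w - z) + mus i / 2 * (norm (z - w))\<^sup>2"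
    using scs assms unfolding strongly_convex_smooth_def by blast
  ultimately show ?thesis by linarith
qed

lemma gderiv_objective: "GDERIV (objective n f) w :> avg n (\<lambda>i. grad (f i) w)"
  using gderiv_avg[of n f w "\<lambda>i. grad (f i) w"] gderiv by (simp add: objective_eq_avg[abs_def])

lemma grad_objective: "grad (objective n f) w = avg n (\<lambda>i. grad (f i) w)"
  by (rule grad_eqI[OF gderiv_objective])

lemma grad_objective_minimizer: "grad (objective n f) wstar = 0"
  unfolding grad_objective by (rule gderiv_zero_at_minimum[OF gderiv_objective minimizer])

lemma strongly_convex_objective:
  "objective n f w \<ge> objective n f z + grad (objective n f) z \<bullet> (w - z) + \<mu> / 2 * (norm (z - w))\<^sup>2"
proof -
  have "avg n (\<lambda>i. f i z + grad (f i) z \<bullet> (w - z) + \<mu> / 2 * (norm (z - w))\<^sup>2) \<le> avg n (\<lambda>i. f i w)"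
    by (intro avg_mono strongly_convex_component)
  then show ?thesis
    by (simp only: avg_add avg_inner_left avg_const[OF n_pos] grad_objective objective_eq_avg)
qed

lemma distance_le_gap: "(norm (w - wstar))\<^sup>2 \<le> 2 / \<mu> * gap w"
  using strongly_convex_objective[of wstar w] mu_pos
  by (simp add: grad_objective_minimizer gap_def norm_minus_commute field_simps)

lemma gap_le_inner_grad: "gap w \<le> grad (objective n f) w \<bullet> (w - wstar)"
proof -
  have "0 \<le> \<mu> / 2 * (norm (w - wstar))\<^sup>2"
    using mu_pos by simp
  then show ?thesis
    using strongly_convex_objective[of w wstar] by (simp add: gap_def inner_diff_right)
qed

text \<open>The linear terms of the componentwise bounds average to zero, because the gradient of the
  objective vanishes at the minimizer.\<close>

lemma mean_gradient_deviation_le_gap: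
  "avg n (\<lambda>i. (norm (grad (f i) w - grad (f i) wstar))\<^sup>2) \<le> 2 * L * gap w"
proof -
  have "avg n (\<lambda>i. (norm (grad (f i) w - grad (f i) wstar))\<^sup>2)
      \<le> avg n (\<lambda>i. 2 * L * (f i w - f i wstar - grad (f i) wstar \<bullet> (w - wstar)))"
  proof (rule avg_mono)
    fix i assume i: "i \<in> {1..n}"
    show "(norm (grad (f i) w - grad (f i) wstar))\<^sup>2
        \<le> 2 * L * (f i w - f i wstar - grad (f i) wstar \<bullet> (w - wstar))"
    proof (rule gradient_difference_bound)
      show "norm (grad (f i) x - grad (f i) y) \<le> L * norm (x - y)" for x y
        using scs i by (simp add: strongly_convex_smooth_def)
      show "f i w \<ge> f i z + grad (f i) z \<bullet> (w - z)" for w z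
      proof -
        have "0 \<le> \<mu> / 2 * (norm (z - w))\<^sup>2"
          using mu_pos by simp
        then show ?thesis
          using strongly_convex_component[OF i, of z w] by linarith
      qed
    qed (use gderiv[OF i] L_pos in auto)
  qed
  also have "\<dots> = 2 * L * (gap w - grad (objective n f) wstar \<bullet> (w - wstar))"
    by (simp only: avg_mult_left avg_diff avg_inner_left grad_objective objective_eq_avg gap_def)
  finally show ?thesis by (simp add: grad_objective_minimizer)
qed

section \<open>One step of the inner loop\<close>

lemma avg_direction: "avg n (\<lambda>i. direction n f B ws i w) = grad (objective n f) w"
  by (simp add: direction_def avg_add avg_diff avg_const n_pos grad_objective mean_matrix_eq_avg
      matrix_vector_mult_diff_rdistrib avg_matrix_vector_mult)

text \<open>The direction is \<open>X i\<close> minus its mean plus the full gradient, where \<open>X i\<close> is the error of the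
  matrix \<open>B i\<close> in predicting the change of the \<open>i\<close>-th gradient. The variance condition
  bounds the mean square of \<open>X i\<close> by \<open>\<alpha>\<close> times that of the change itself, which is split at the
  minimizer.\<close>

lemma direction_second_moment:
  assumes var: "avg n (\<lambda>i. (norm (grad (f i) w - grad (f i) ws - B i *v (w - ws)))\<^sup>2)
      \<le> \<alpha> * avg n (\<lambda>i. (norm (grad (f i) w - grad (f i) ws))\<^sup>2)"
    and "\<alpha> > 0"
  shows "avg n (\<lambda>i. (norm (direction n f B ws i w))\<^sup>2)
      \<le> 2 * L * (2 * \<alpha> + 1) * gap w + 4 * L * \<alpha> * gap ws"
proof -
  define X where "X i = grad (f i) w - grad (f i) ws - B i *v (w - ws)" for i
  have avg_X: "avg n X = grad (objective n f) w - grad (objective n f) ws - avg n B *v (w - ws)"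
    by (simp add: X_def[abs_def] avg_diff grad_objective avg_matrix_vector_mult)
  have "direction n f B ws i w = X i - avg n X + grad (objective n f) w" for i
    by (simp add: direction_def X_def avg_X mean_matrix_eq_avg matrix_vector_mult_diff_rdistrib)
  then have "avg n (\<lambda>i. (norm (direction n f B ws i w))\<^sup>2)
      \<le> avg n (\<lambda>i. (norm (X i))\<^sup>2) + (norm (grad (objective n f) w))\<^sup>2"
    by (simp add: avg_norm_square_centred n_pos)
  moreover have "(norm (grad (objective n f) w))\<^sup>2 \<le> 2 * L * gap w"
  proof -
    have "grad (objective n f) w = avg n (\<lambda>i. grad (f i) w - grad (f i) wstar)"
      using grad_objective_minimizer by (simp add: avg_diff grad_objective)
    then show ?thesis
      using norm_avg_square_le[OF n_pos, of "\<lambda>i. grad (f i) w - grad (f i) wstar"]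
        mean_gradient_deviation_le_gap[of w] by simp
  qed
  moreover have "avg n (\<lambda>i. (norm (X i))\<^sup>2) \<le> \<alpha> * (4 * L * gap w + 4 * L * gap ws)"
  proof -
    have "(norm (x - y))\<^sup>2 \<le> 2 * (norm x)\<^sup>2 + 2 * (norm y)\<^sup>2" for x y :: "real^'d"
      using zero_le_power2[of "norm (x + y)"]
      by (simp add: power2_norm_eq_inner inner_add_left inner_add_right
          inner_diff_left inner_diff_right inner_commute)
    from this[of "a - c" "b - c" for a b c]
    have split: "(norm (a - b))\<^sup>2 \<le> 2 * (norm (a - c))\<^sup>2 + 2 * (norm (b - c))\<^sup>2" for a b c :: "real^'d"
      by simp
    have "avg n (\<lambda>i. (norm (grad (f i) w - grad (f i) ws))\<^sup>2)
        \<le> avg n (\<lambda>i. 2 * (norm (grad (f i) w - grad (f i) wstar))\<^sup>2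
                    + 2 * (norm (grad (f i) ws - grad (f i) wstar))\<^sup>2)"
      by (intro avg_mono split)
    also have "\<dots> \<le> 4 * L * gap w + 4 * L * gap ws"
      using mean_gradient_deviation_le_gap[of w] mean_gradient_deviation_le_gap[of ws]
      by (simp add: avg_add avg_mult_left)
    finally show ?thesis
      using var \<open>\<alpha> > 0\<close> by (auto simp: X_def[abs_def] intro: order_trans mult_left_mono)
  qed
  ultimately show ?thesis
    by (simp add: algebra_simps)
qed

text \<open>Expanding the square leaves a cross term, which gains \<open>2 * \<eta> * gap w\<close> by convexity, and the
  second moment, whose part proportional to \<open>gap w\<close> takes back the fraction
  \<open>\<eta> * L * (2 * \<alpha> + 1)\<close> of that gain.\<close>

lemma step_distance:
  assumes var: "avg n (\<lambda>i. (norm (grad (f i) w - grad (f i) ws - B i *v (w - ws)))\<^sup>2)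
      \<le> \<alpha> * avg n (\<lambda>i. (norm (grad (f i) w - grad (f i) ws))\<^sup>2)"
    and "\<alpha> > 0" and "\<eta> > 0"
  shows "avg n (\<lambda>i. (norm (w - \<eta> *\<^sub>R direction n f B ws i w - wstar))\<^sup>2)
      \<le> (norm (w - wstar))\<^sup>2 - 2 * \<eta> * (1 - \<eta> * L * (2 * \<alpha> + 1)) * gap w
         + 4 * L * \<alpha> * \<eta>\<^sup>2 * gap ws"
proof -
  let ?v = "\<lambda>i. direction n f B ws i w"
  have expand: "(norm (w - \<eta> *\<^sub>R v - wstar))\<^sup>2
      = (norm (w - wstar))\<^sup>2 + (- 2 * \<eta>) * (v \<bullet> (w - wstar)) + \<eta>\<^sup>2 * (norm v)\<^sup>2" for v
    unfolding power2_norm_eq_inner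
    by (simp add: algebra_simps inner_commute power2_eq_square)
  have "avg n (\<lambda>i. (norm (w - \<eta> *\<^sub>R ?v i - wstar))\<^sup>2)
      = avg n (\<lambda>i. (norm (w - wstar))\<^sup>2 + (- 2 * \<eta>) * (?v i \<bullet> (w - wstar)) + \<eta>\<^sup>2 * (norm (?v i))\<^sup>2)"
    by (simp only: expand)
  also have "\<dots> = (norm (w - wstar))\<^sup>2 + (- 2 * \<eta>) * (grad (objective n f) w \<bullet> (w - wstar))
      + \<eta>\<^sup>2 * avg n (\<lambda>i. (norm (?v i))\<^sup>2)"
    by (simp only: avg_add avg_mult_left avg_inner_left avg_const[OF n_pos] avg_direction)
  also have "\<dots> \<le> (norm (w - wstar))\<^sup>2 + (- 2 * \<eta>) * gap w
      + \<eta>\<^sup>2 * (2 * L * (2 * \<alpha> + 1) * gap w + 4 * L * \<alpha> * gap ws)"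
    using \<open>\<eta> > 0\<close> gap_le_inner_grad[of w] direction_second_moment[OF var \<open>\<alpha> > 0\<close>]
    by (intro add_mono mult_left_mono mult_left_mono_neg order_refl) auto
  also have "\<dots> = (norm (w - wstar))\<^sup>2 - 2 * \<eta> * (1 - \<eta> * L * (2 * \<alpha> + 1)) * gap w
         + 4 * L * \<alpha> * \<eta>\<^sup>2 * gap ws"
    by (simp add: algebra_simps power2_eq_square)
  finally show ?thesis .
qed

section \<open>One epoch\<close>

text \<open>The one-step bound telescopes over the \<open>m\<close> inner steps, and the initial squared distance
  is paid for by strong convexity. Choosing the next snapshot uniformly among the \<open>m\<close> iterates at
  which the gap was collected turns the sum of the expected gaps into an expectation.\<close>

lemma epoch_contraction:
  assumes "m > 0" and "\<alpha> > 0" and "\<eta> > 0" and c_pos: "1 - \<eta> * L * (2 * \<alpha> + 1) > 0"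
    and var: "\<And>t xs. t < m \<Longrightarrow> xs \<in> set_pmf (replicate_pmf t (index_pmf n)) \<Longrightarrow>
        (let w = inner_iterate n f \<eta> B ws xs in
          avg n (\<lambda>i. (norm (grad (f i) w - grad (f i) ws - B i *v (w - ws)))\<^sup>2)
            \<le> \<alpha> * avg n (\<lambda>i. (norm (grad (f i) w - grad (f i) ws))\<^sup>2))"
  shows "measure_pmf.expectation (epoch_pmf n m)
           (\<lambda>e. gap (inner_iterate n f \<eta> B ws (take (snd e) (fst e))))
       \<le> (1 / (\<mu> * \<eta> * (1 - \<eta> * L * (2 * \<alpha> + 1)) * real m)
           + 2 * L * \<eta> * \<alpha> / (1 - \<eta> * L * (2 * \<alpha> + 1))) * gap ws"
proof -
  define W where "W = inner_iterate n f \<eta> B ws"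
  define E where "E t h = measure_pmf.expectation (replicate_pmf t (index_pmf n)) h"
    for t and h :: "nat list \<Rightarrow> real"
  define c where "c = 1 - \<eta> * L * (2 * \<alpha> + 1)"
  define K where "K = 4 * L * \<alpha> * \<eta>\<^sup>2 * gap ws"
  define D where "D xs = (norm (W xs - wstar))\<^sup>2" for xs
  define S where "S = (\<Sum>t<m. E t (\<lambda>xs. gap (W xs)))"
  have fin: "finite (set_pmf (replicate_pmf t (index_pmf n)))" for t
    by (simp add: finite_set_replicate_pmf finite_set_index_pmf n_pos)
  have W_snoc: "W (xs @ [i]) = W xs - \<eta> *\<^sub>R direction n f B ws i (W xs)" for xs i
    by (simp add: W_def inner_iterate_def)
  have step: "E (Suc t) D \<le> E t D - 2 * \<eta> * c * E t (\<lambda>xs. gap (W xs)) + K" if "t < m" for t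
  proof -
    have "E (Suc t) D = E t (\<lambda>xs. avg n (\<lambda>i. D (xs @ [i])))"
      unfolding E_def
      by (subst expectation_replicate_snoc)
         (simp_all add: finite_set_index_pmf expectation_index_eq_avg n_pos)
    also have "\<dots> \<le> E t (\<lambda>xs. D xs - 2 * \<eta> * c * gap (W xs) + K)"
      unfolding E_def
    proof (rule expectation_mono_finite[OF fin])
      fix xs assume "xs \<in> set_pmf (replicate_pmf t (index_pmf n))"
      from var[OF \<open>t < m\<close> this, folded W_def] show "avg n (\<lambda>i. D (xs @ [i])) \<le> D xs - 2 * \<eta> * c * gap (W xs) + K"
        using step_distance[of "W xs" ws B \<alpha> \<eta>] \<open>\<alpha> > 0\<close> \<open>\<eta> > 0\<close>
        by (simp add: D_def W_snoc c_def K_def Let_def)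
    qed
    also have "\<dots> = E t D - 2 * \<eta> * c * E t (\<lambda>xs. gap (W xs)) + K"
      unfolding E_def by (simp add: integrable_measure_pmf_finite[OF fin])
    finally show ?thesis .
  qed
  have "E t D + 2 * \<eta> * c * (\<Sum>s<t. E s (\<lambda>xs. gap (W xs))) \<le> (norm (ws - wstar))\<^sup>2 + real t * K"
    if "t \<le> m" for t
    using that
  proof (induction t)
    case 0
    then show ?case by (simp add: E_def D_def W_def inner_iterate_def)
  next
    case (Suc t)
    then show ?case using step[of t] by (simp add: algebra_simps)
  qed
  then have "E m D + 2 * \<eta> * c * S \<le> (norm (ws - wstar))\<^sup>2 + real m * K"
    by (simp add: S_def)
  moreover have "E m D \<ge> 0"
    by (simp add: E_def D_def)
  ultimately have "2 * \<eta> * c * S \<le> 2 / \<mu> * gap ws + real m * K"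
    using distance_le_gap[of ws] by linarith
  then have "S / real m \<le> (1 / (\<mu> * \<eta> * c * real m) + 2 * L * \<eta> * \<alpha> / c) * gap ws"
    using \<open>\<eta> > 0\<close> \<open>m > 0\<close> c_pos mu_pos unfolding K_def c_def[symmetric]
    by (simp add: field_simps power2_eq_square)
  then show ?thesis
    using expectation_epoch[OF n_pos \<open>m > 0\<close>, of "\<lambda>xs. gap (W xs)"]
    by (simp add: S_def E_def W_def c_def)
qed

end

section \<open>All epochs\<close>

theorem theorem4p1:
  fixes n m k :: nat
    and f :: "nat \<Rightarrow> real^'d \<Rightarrow> real"
    and mus :: "nat \<Rightarrow> real"
    and \<mu> L \<eta> \<alpha> \<beta> :: real
    and A :: "history \<Rightarrow> nat \<Rightarrow> real^'d^'d"
    and w0 wstar :: "real^'d"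
  assumes "n \<ge> 1" and "m \<ge> 1"
    and "\<And>i. i \<in> {1..n} \<Longrightarrow> twice_continuously_differentiable (f i)"
    and "strongly_convex_smooth n f mus L"
    and "\<mu> = Min (mus ` {1..n})"
    and "\<eta> > 0" and "\<alpha> > 0"
    and "variance_condition n m f \<eta> A w0 \<alpha>"
    and "\<And>w. objective n f wstar \<le> objective n f w"
    and "1 - \<eta> * L * (2 * \<alpha> + 1) > 0"
    and "\<beta> = 1 / (\<mu> * \<eta> * (1 - \<eta> * L * (2 * \<alpha> + 1)) * real m)
             + 2 * L * \<eta> * \<alpha> / (1 - \<eta> * L * (2 * \<alpha> + 1))"
    and "\<beta> < 1"
    and "k \<ge> 1"
  shows "measure_pmf.expectation (history_pmf n m k)
           (\<lambda>h. objective n f (snapshot n f \<eta> A w0 h) - objective n f wstar)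
       \<le> \<beta> ^ k * measure_pmf.expectation (history_pmf n m 0)
           (\<lambda>h. objective n f (snapshot n f \<eta> A w0 h) - objective n f wstar)"
proof -
  interpret strongly_convex_average n f mus \<mu> L wstar
    using assms(1,3-5,9) by unfold_locales (auto simp: twice_continuously_differentiable_def)
  let ?x = "snapshot n f \<eta> A w0"
  let ?E = "\<lambda>j. measure_pmf.expectation (history_pmf n m j) (\<lambda>h. gap (?x h))"
  have fin_e: "finite (set_pmf (epoch_pmf n m))"
    using assms(1,2) by (intro finite_set_epoch_pmf) auto
  have m_pos: "m > 0"
    using assms(2) by simp
  have \<beta>_nonneg: "\<beta> \<ge> 0"
    unfolding assms(11) using assms(6,7,10) mu_pos L_pos
    by (intro add_nonneg_nonneg divide_nonneg_nonneg mult_nonneg_nonneg) auto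
  have epoch: "measure_pmf.expectation (epoch_pmf n m) (\<lambda>e. gap (?x (e # h))) \<le> \<beta> * gap (?x h)"
    if h: "h \<in> set_pmf (history_pmf n m j)" for j h
  proof -
    have "let w = inner_iterate n f \<eta> (A h) (?x h) xs in
          avg n (\<lambda>i. (norm (grad (f i) w - grad (f i) (?x h) - A h i *v (w - ?x h)))\<^sup>2)
            \<le> \<alpha> * avg n (\<lambda>i. (norm (grad (f i) w - grad (f i) (?x h)))\<^sup>2)"
      if "t < m" and "xs \<in> set_pmf (replicate_pmf t (index_pmf n))" for t xs
      \<comment> \<open>The condition numbers epochs and steps from one, hence the shifts.\<close>
      using assms(8)[unfolded variance_condition_def, rule_format, of "Suc j" h "Suc t" xs] h that
      by (simp add: expectation_index_eq_avg n_pos Let_def)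
    from epoch_contraction[OF m_pos assms(7,6,10) this] show ?thesis
      by (simp add: assms(11))
  qed
  have step: "?E (Suc j) \<le> \<beta> * ?E j" for j
  proof -
    have "?E (Suc j) = measure_pmf.expectation (history_pmf n m j)
        (\<lambda>h. measure_pmf.expectation (epoch_pmf n m) (\<lambda>e. gap (?x (e # h))))"
      unfolding history_pmf_def by (rule expectation_replicate_Cons[OF fin_e])
    also have "\<dots> \<le> measure_pmf.expectation (history_pmf n m j) (\<lambda>h. \<beta> * gap (?x h))"
      using epoch fin_e
      by (intro expectation_mono_finite) (auto simp: history_pmf_def finite_set_replicate_pmf)
    finally show ?thesis by simp
  qed
  have "?E j \<le> \<beta> ^ j * ?E 0" for j
  proof (induction j)
    case (Suc j)
    have "?E (Suc j) \<le> \<beta> * (\<beta> ^ j * ?E 0)"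
      using step[of j] mult_left_mono[OF Suc \<beta>_nonneg] by linarith
    then show ?case by (simp add: mult.assoc)
  qed simp
  then show ?thesis by (simp add: gap_def)
qed

end
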